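(* In the setting described in the context, let $\eta\in[0,1)$ and let $h\in\mathbb{R}$ satisfy $1+\eta h>0$ and $1-(1-\eta)h>0$. Set \[ \kappa=\frac{1-(1-\eta)h}{1+\eta h}. \] Then \[ \big(K(\eta)^\circ-he_0\big)^\circ=\frac{1}{1-(1-\eta)h}\,K(\eta,\kappa). \]
   Context: Let $x_1,\dots,x_m\in\mathbb{R}^n$ and $Q=\operatorname{conv}\{\pm x_i: i\in[m]\}$, assumed to contain a neighborhood of the origin; $B_2^n$ is the Euclidean unit ball; $Q_1=\operatorname{conv}(Q\cup B_2^n)$. For a set $L$, its polar is $L^\circ=\{y:\langle y,z\rangle\le 1\ \forall z\in L\}$; $Q_1^\circ=Q^\circ\cap B_2^n$. Equip $\mathbb{R}^{n+1}$ with orthonormal basis $e_0,\dots,e_n$ and identify $\mathbb{R}^n$ with $\operatorname{span}\{e_1,\dots,e_n\}$. For $\eta\in\mathbb{R}$, $\kappa>0$ define $K(\eta,\kappa)=\operatorname{conv}\big((1-\eta)e_0+Q,\ -\kappa\eta e_0+\kappa Q_1^\circ\big)$ and $K(\eta)=K(\eta,1)=\operatorname{conv}(e_0+Q,Q_1^\circ)-\eta e_0$. *)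

theory Defs
  imports "HOL-Analysis.Analysis"
begin

text \<open>R^{n+1} is modelled as real \<times> 'a, with e_0 = (1,0) and R^n = {0} \<times> 'a.\<close>

definition polar :: "'b::real_inner set \<Rightarrow> 'b set" where
  "polar L = {y. \<forall>z\<in>L. inner y z \<le> 1}"

definition Qset :: "(nat \<Rightarrow> 'a::euclidean_space) \<Rightarrow> nat \<Rightarrow> 'a set" where
  "Qset x m = convex hull ((\<lambda>i. x i) ` {1..m} \<union> (\<lambda>i. - x i) ` {1..m})"

definition Q1set :: "(nat \<Rightarrow> 'a::euclidean_space) \<Rightarrow> nat \<Rightarrow> 'a set" where
  "Q1set x m = convex hull (Qset x m \<union> cball 0 1)"

definition e0 :: "real \<times> 'a::euclidean_space" where
  "e0 = (1, 0)"

definition emb :: "'a::euclidean_space \<Rightarrow> real \<times> 'a" where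
  "emb v = (0, v)"

definition Kset :: "(nat \<Rightarrow> 'a::euclidean_space) \<Rightarrow> nat \<Rightarrow> real \<Rightarrow> real \<Rightarrow> (real \<times> 'a) set" where
  "Kset x m \<eta> \<kappa> = convex hull
     ((\<lambda>q. (1 - \<eta>) *\<^sub>R e0 + emb q) ` Qset x m \<union>
      (\<lambda>p. (- \<kappa> * \<eta>) *\<^sub>R e0 + \<kappa> *\<^sub>R emb p) ` polar (Q1set x m))"

end

theory Submission
  imports Defs
begin

text \<open>
  By the bipolar theorem, polarizing the translate (polar S) - a of the polar of a compact
  convex body S containing 0 gives the image of S under the projective map
  z \<mapsto> z / (1 - \<langle>z, a\<rangle>). For a = h e0 the denominator is constant on each of the
  two horizontal slices whose convex hull is K(\<eta>), so the map merely rescales the slices;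
  pulling out the factor 1 / (1 - (1 - \<eta>) h) of the upper slice leaves the lower one
  scaled by exactly \<kappa>.
\<close>

lemma polar_eq_Inter_halfspaces: "polar L = (\<Inter>z\<in>L. {y. inner z y \<le> 1})"
  by (auto simp: polar_def inner_commute)

lemma convex_polar: "convex (polar L)"
  by (simp add: polar_eq_Inter_halfspaces convex_INT convex_halfspace_le)

lemma closed_polar: "closed (polar L)"
  by (simp add: polar_eq_Inter_halfspaces closed_INT closed_halfspace_le)

lemma zero_in_polar: "0 \<in> polar L"
  by (simp add: polar_def)

lemma polar_subset_cball:
  assumes "cball 0 1 \<subseteq> L"
  shows "polar L \<subseteq> cball 0 1"
proof
  fix y assume y: "y \<in> polar L"
  show "y \<in> cball 0 1"
  proof (cases "y = 0")
    case False
    then have "(1 / norm y) *\<^sub>R y \<in> L"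
      using assms by auto
    then have "inner y ((1 / norm y) *\<^sub>R y) \<le> 1"
      using y unfolding polar_def by blast
    moreover have "inner y ((1 / norm y) *\<^sub>R y) = norm y"
      using False by (simp add: power2_eq_square flip: power2_norm_eq_inner)
    ultimately show ?thesis
      by simp
  qed simp
qed

lemma polar_polar:
  fixes S :: "'b::euclidean_space set"
  assumes "closed S" "convex S" "0 \<in> S"
  shows "polar (polar S) = S"
proof
  show "S \<subseteq> polar (polar S)"
    by (auto simp: polar_def inner_commute)
  show "polar (polar S) \<subseteq> S"
  proof
    fix z assume z: "z \<in> polar (polar S)"
    show "z \<in> S"
    proof (rule ccontr)
      assume "z \<notin> S"
      then obtain a b where ab: "inner a z < b" "\<forall>x\<in>S. inner a x > b"
        using separating_hyperplane_closed_point[OF assms(2,1)] by blast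
      then have b: "b < 0"
        using assms(3) by force
      have "(1 / b) *\<^sub>R a \<in> polar S"
        using ab b by (auto simp: polar_def field_simps)
      then have "inner z ((1 / b) *\<^sub>R a) \<le> 1"
        using z unfolding polar_def by blast
      then show False
        using ab b by (simp add: inner_commute field_simps)
    qed
  qed
qed

lemma polar_support_pos:
  fixes S :: "'b::real_inner set"
  assumes "bounded S" "y \<noteq> 0" "\<And>z. z \<in> polar S \<Longrightarrow> inner y z \<le> r"
  shows "r > 0"
proof -
  obtain R where R: "R > 0" "\<And>x. x \<in> S \<Longrightarrow> norm x \<le> R"
    using assms(1) bounded_pos by blast
  have "(1 / (R * norm y)) *\<^sub>R y \<in> polar S"
  proof (clarsimp simp: polar_def)
    fix x assume "x \<in> S"
    have "inner y x \<le> norm y * R"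
      using norm_cauchy_schwarz[of y x] R(2)[OF \<open>x \<in> S\<close>]
      by (meson mult_left_mono norm_ge_zero order_trans)
    then show "inner y x / (R * norm y) \<le> 1"
      using R(1) \<open>y \<noteq> 0\<close> by (simp add: field_simps)
  qed
  from assms(3)[OF this] have "norm y / R \<le> r"
    using \<open>y \<noteq> 0\<close> by (simp add: dot_square_norm power2_eq_square)
  then show ?thesis
    using R(1) \<open>y \<noteq> 0\<close> by (meson divide_pos_pos less_le_trans zero_less_norm_iff)
qed

lemma polar_translation:
  fixes S :: "'b::euclidean_space set"
  assumes "compact S" "convex S" "0 \<in> S" "\<And>x. x \<in> S \<Longrightarrow> inner x a < 1"
  shows "polar ((\<lambda>z. z - a) ` polar S) = (\<lambda>x. (1 / (1 - inner x a)) *\<^sub>R x) ` S"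
proof
  show "(\<lambda>x. (1 / (1 - inner x a)) *\<^sub>R x) ` S \<subseteq> polar ((\<lambda>z. z - a) ` polar S)"
  proof (clarsimp simp: polar_def)
    fix x z assume x: "x \<in> S" and z: "\<forall>y\<in>S. inner z y \<le> 1"
    have "inner x z \<le> 1"
      using z x by (simp add: inner_commute)
    then show "inner x (z - a) / (1 - inner x a) \<le> 1"
      using assms(4)[OF x] by (simp add: inner_diff_right)
  qed
  show "polar ((\<lambda>z. z - a) ` polar S) \<subseteq> (\<lambda>x. (1 / (1 - inner x a)) *\<^sub>R x) ` S"
  proof
    fix y assume "y \<in> polar ((\<lambda>z. z - a) ` polar S)"
    then have y: "\<And>z. z \<in> polar S \<Longrightarrow> inner y z \<le> 1 + inner y a"
      by (auto simp: polar_def inner_diff_right)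
    define s where "s = 1 + inner y a"
    have "s > 0"
    proof (cases "y = 0")
      case False
      then show ?thesis
        using polar_support_pos[OF compact_imp_bounded[OF assms(1)]] y by (simp add: s_def)
    qed (simp add: s_def)
    define x where "x = (1 / s) *\<^sub>R y"
    have "x \<in> polar (polar S)"
      using y \<open>s > 0\<close> by (auto simp: polar_def[of "polar S"] x_def s_def field_simps)
    then have "x \<in> S"
      using polar_polar[OF compact_imp_closed assms(2,3)] assms(1) by simp
    moreover have "1 - inner x a = 1 / s"
      using \<open>s > 0\<close> by (simp add: x_def s_def field_simps)
    then have "y = (1 / (1 - inner x a)) *\<^sub>R x"
      using \<open>s > 0\<close> by (simp add: x_def)
    ultimately show "y \<in> (\<lambda>x. (1 / (1 - inner x a)) *\<^sub>R x) ` S"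
      by blast
  qed
qed

context
  fixes S T :: "'b::euclidean_space set" and a :: 'b and c d :: real
  assumes S: "convex S" "S \<noteq> {}" and T: "convex T" "T \<noteq> {}"
    and level_S: "\<And>s. s \<in> S \<Longrightarrow> 1 - inner s a = c"
    and level_T: "\<And>t. t \<in> T \<Longrightarrow> 1 - inner t a = d"
    and c_pos: "c > 0" and d_pos: "d > 0"
begin

lemma perspective_level_convex_combination:
  assumes "u + v = 1" "s \<in> S" "t \<in> T"
  shows "1 - inner (u *\<^sub>R s + v *\<^sub>R t) a = u * c + v * d"
proof -
  have sa: "inner s a = 1 - c" and ta: "inner t a = 1 - d"
    using level_S[OF assms(2)] level_T[OF assms(3)] by simp_all
  show ?thesis
    unfolding inner_add_left inner_scaleR_left sa ta using assms(1) by (simp add: algebra_simps)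
qed

lemma perspective_convex_hull_Un_subset:
  "(\<lambda>z. (1 / (1 - inner z a)) *\<^sub>R z) ` (convex hull (S \<union> T))
     \<subseteq> (\<lambda>z. (1 / c) *\<^sub>R z) ` (convex hull (S \<union> (*\<^sub>R) (c / d) ` T))"
proof (rule image_subsetI)
  fix z assume "z \<in> convex hull (S \<union> T)"
  then obtain u v s t where z: "z = u *\<^sub>R s + v *\<^sub>R t" and uv: "u \<ge> 0" "v \<ge> 0" "u + v = 1"
    and st: "s \<in> S" "t \<in> T"
    unfolding convex_hull_union_two[OF S T] by blast
  define w where "w = u * c + v * d"
  have w: "w > 0"
    using uv c_pos d_pos unfolding w_def by (cases "u = 0") (auto intro: add_pos_nonneg)
  have "(1 / (1 - inner z a)) *\<^sub>R z
      = (1 / c) *\<^sub>R ((u * c / w) *\<^sub>R s + (v * d / w) *\<^sub>R ((c / d) *\<^sub>R t))"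
    using perspective_level_convex_combination[OF uv(3) st] w c_pos d_pos
    by (simp add: z w_def scaleR_add_right)
  moreover have "(u * c / w) *\<^sub>R s + (v * d / w) *\<^sub>R ((c / d) *\<^sub>R t)
      \<in> convex hull (S \<union> (*\<^sub>R) (c / d) ` T)"
    using uv st w c_pos d_pos
    by (intro convexD[OF convex_convex_hull] hull_inc) (auto simp: w_def add_divide_distrib[symmetric])
  ultimately show "(1 / (1 - inner z a)) *\<^sub>R z
      \<in> (\<lambda>z. (1 / c) *\<^sub>R z) ` (convex hull (S \<union> (*\<^sub>R) (c / d) ` T))"
    by blast
qed

lemma perspective_convex_hull_Un_supset:
  "(\<lambda>z. (1 / c) *\<^sub>R z) ` (convex hull (S \<union> (*\<^sub>R) (c / d) ` T))
     \<subseteq> (\<lambda>z. (1 / (1 - inner z a)) *\<^sub>R z) ` (convex hull (S \<union> T))"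
proof (rule image_subsetI)
  fix z assume "z \<in> convex hull (S \<union> (*\<^sub>R) (c / d) ` T)"
  then obtain u v s t where z: "z = u *\<^sub>R s + v *\<^sub>R ((c / d) *\<^sub>R t)" and uv: "u \<ge> 0" "v \<ge> 0" "u + v = 1"
    and st: "s \<in> S" "t \<in> T"
    using convex_hull_union_two[OF S convex_scaling[OF T(1)]] T(2) by blast
  define w where "w = u / c + v / d"
  have w: "w > 0"
    using uv c_pos d_pos unfolding w_def by (cases "u = 0") (auto intro: add_pos_nonneg)
  define y where "y = (u / c / w) *\<^sub>R s + (v / d / w) *\<^sub>R t"
  have coeffs: "u / c / w + v / d / w = 1"
    using w unfolding add_divide_distrib[symmetric] w_def[symmetric] by simp
  have y: "y \<in> convex hull (S \<union> T)"
    unfolding y_def using uv st w coeffs c_pos d_pos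
    by (intro convexD[OF convex_convex_hull] hull_inc) auto
  have "1 - inner y a = u / c / w * c + v / d / w * d"
    using perspective_level_convex_combination[OF coeffs st] by (simp add: y_def)
  also have "\<dots> = (u + v) / w"
    using c_pos d_pos by (simp add: add_divide_distrib)
  finally have "(1 / c) *\<^sub>R z = (1 / (1 - inner y a)) *\<^sub>R y"
    using w uv(3) c_pos d_pos by (simp add: z y_def scaleR_add_right)
  with y show "(1 / c) *\<^sub>R z \<in> (\<lambda>z. (1 / (1 - inner z a)) *\<^sub>R z) ` (convex hull (S \<union> T))"
    by blast
qed

lemma perspective_convex_hull_Un:
  "(\<lambda>z. (1 / (1 - inner z a)) *\<^sub>R z) ` (convex hull (S \<union> T))
     = (\<lambda>z. (1 / c) *\<^sub>R z) ` (convex hull (S \<union> (*\<^sub>R) (c / d) ` T))"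
  using perspective_convex_hull_Un_subset perspective_convex_hull_Un_supset by (rule equalityI)

end

definition Kset_top :: "(nat \<Rightarrow> 'a::euclidean_space) \<Rightarrow> nat \<Rightarrow> real \<Rightarrow> (real \<times> 'a) set" where
  "Kset_top x m \<eta> = (\<lambda>q. (1 - \<eta>) *\<^sub>R e0 + emb q) ` Qset x m"

definition Kset_bottom :: "(nat \<Rightarrow> 'a::euclidean_space) \<Rightarrow> nat \<Rightarrow> real \<Rightarrow> (real \<times> 'a) set" where
  "Kset_bottom x m \<eta> = (\<lambda>p. (- \<eta>) *\<^sub>R e0 + emb p) ` polar (Q1set x m)"

lemma Kset_eq_convex_hull:
  "Kset x m \<eta> \<kappa> = convex hull (Kset_top x m \<eta> \<union> (*\<^sub>R) \<kappa> ` Kset_bottom x m \<eta>)"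
  unfolding Kset_def Kset_top_def Kset_bottom_def image_image
  by (simp add: scaleR_add_right scaleR_diff_right)

lemma inner_e0: "inner z e0 = fst z" "inner e0 z = fst z"
  by (cases z, simp add: e0_def)+

lemma fst_Kset_top: "z \<in> Kset_top x m \<eta> \<Longrightarrow> fst z = 1 - \<eta>"
  by (auto simp: Kset_top_def e0_def emb_def)

lemma fst_Kset_bottom: "z \<in> Kset_bottom x m \<eta> \<Longrightarrow> fst z = - \<eta>"
  by (auto simp: Kset_bottom_def e0_def emb_def)

lemma linear_emb: "linear emb"
  by (auto simp: linear_iff emb_def)

lemma convex_Qset: "convex (Qset x m)"
  by (simp add: Qset_def convex_convex_hull)

lemma compact_Qset: "compact (Qset x m)"
  unfolding Qset_def by (intro compact_convex_hull finite_imp_compact) auto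

lemma compact_polar_Q1set: "compact (polar (Q1set x m))"
proof -
  have "cball 0 1 \<subseteq> Q1set x m"
    unfolding Q1set_def by (auto intro: hull_inc)
  then have "bounded (polar (Q1set x m))"
    by (meson bounded_cball bounded_subset polar_subset_cball)
  then show ?thesis
    by (simp add: compact_eq_bounded_closed closed_polar)
qed

lemma convex_affine_image_emb: "convex S \<Longrightarrow> convex ((\<lambda>q. c + emb q) ` S)"
  using convex_translation[OF convex_linear_image[OF linear_emb]] by (simp add: image_image)

lemma compact_affine_image_emb: "compact S \<Longrightarrow> compact ((\<lambda>q. c + emb q) ` S)"
  by (rule compact_continuous_image) (auto simp: emb_def intro!: continuous_intros)

lemma convex_Kset_top: "convex (Kset_top x m \<eta>)"
  unfolding Kset_top_def by (rule convex_affine_image_emb[OF convex_Qset])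

lemma compact_Kset_top: "compact (Kset_top x m \<eta>)"
  unfolding Kset_top_def by (rule compact_affine_image_emb[OF compact_Qset])

lemma convex_Kset_bottom: "convex (Kset_bottom x m \<eta>)"
  unfolding Kset_bottom_def by (rule convex_affine_image_emb[OF convex_polar])

lemma compact_Kset_bottom: "compact (Kset_bottom x m \<eta>)"
  unfolding Kset_bottom_def by (rule compact_affine_image_emb[OF compact_polar_Q1set])

lemma zero_in_Kset:
  assumes "0 \<in> Qset x m" "0 \<le> \<eta>" "\<eta> \<le> 1"
  shows "0 \<in> Kset x m \<eta> 1"
proof -
  have "(1 - \<eta>) *\<^sub>R e0 + emb 0 \<in> Kset_top x m \<eta>" "(- \<eta>) *\<^sub>R e0 + emb 0 \<in> Kset_bottom x m \<eta>"
    using assms(1) zero_in_polar by (auto simp: Kset_top_def Kset_bottom_def)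
  then have "\<eta> *\<^sub>R ((1 - \<eta>) *\<^sub>R e0 + emb 0) + (1 - \<eta>) *\<^sub>R ((- \<eta>) *\<^sub>R e0 + emb 0) \<in> Kset x m \<eta> 1"
    unfolding Kset_eq_convex_hull using assms(2,3)
    by (intro convexD[OF convex_convex_hull] hull_inc) auto
  then show ?thesis
    by (simp add: emb_def zero_prod_def algebra_simps)
qed

lemma convex_Kset: "convex (Kset x m \<eta> \<kappa>)"
  by (simp add: Kset_def convex_convex_hull)

lemma compact_Kset: "compact (Kset x m \<eta> \<kappa>)"
  unfolding Kset_eq_convex_hull
  by (intro compact_convex_hull compact_Un compact_scaling compact_Kset_top compact_Kset_bottom)

lemma inner_Kset_lt_1:
  assumes "1 + \<eta> * h > 0" "1 - (1 - \<eta>) * h > 0" "z \<in> Kset x m \<eta> 1"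
  shows "inner z (h *\<^sub>R e0) < 1"
proof -
  have "Kset x m \<eta> 1 \<subseteq> {z. inner (h *\<^sub>R e0) z < 1}"
    unfolding Kset_eq_convex_hull
  proof (intro hull_minimal convex_halfspace_lt subsetI CollectI)
    fix z assume "z \<in> Kset_top x m \<eta> \<union> (*\<^sub>R) 1 ` Kset_bottom x m \<eta>"
    then have "fst z = 1 - \<eta> \<or> fst z = - \<eta>"
      using fst_Kset_top[of z x m \<eta>] fst_Kset_bottom[of z x m \<eta>] by auto
    then show "inner (h *\<^sub>R e0) z < 1"
      using assms(1,2) by (elim disjE) (simp_all add: inner_e0 mult.commute)
  qed
  then show ?thesis
    using assms(3) by (auto simp: inner_commute)
qed

theorem lemma5p1:
  fixes x :: "nat \<Rightarrow> 'a::euclidean_space" and m :: nat and \<eta> h \<kappa> :: real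
  assumes "0 \<in> interior (Qset x m)"
    and "0 \<le> \<eta>" and "\<eta> < 1"
    and "1 + \<eta> * h > 0" and "1 - (1 - \<eta>) * h > 0"
    and "\<kappa> = (1 - (1 - \<eta>) * h) / (1 + \<eta> * h)"
  shows "polar ((\<lambda>z. z - h *\<^sub>R e0) ` polar (Kset x m \<eta> 1))
         = (\<lambda>z. (1 / (1 - (1 - \<eta>) * h)) *\<^sub>R z) ` Kset x m \<eta> \<kappa>"
proof -
  have "0 \<in> Qset x m"
    using assms(1) interior_subset by blast
  then have nonempty: "Kset_top x m \<eta> \<noteq> {}" "Kset_bottom x m \<eta> \<noteq> {}"
    using zero_in_polar by (auto simp: Kset_top_def Kset_bottom_def)
  have level_top: "1 - inner z (h *\<^sub>R e0) = 1 - (1 - \<eta>) * h" if "z \<in> Kset_top x m \<eta>" for z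
    using fst_Kset_top[OF that] by (simp add: inner_e0)
  have level_bottom: "1 - inner z (h *\<^sub>R e0) = 1 + \<eta> * h" if "z \<in> Kset_bottom x m \<eta>" for z
    using fst_Kset_bottom[OF that] by (simp add: inner_e0)
  have "polar ((\<lambda>z. z - h *\<^sub>R e0) ` polar (Kset x m \<eta> 1))
      = (\<lambda>z. (1 / (1 - inner z (h *\<^sub>R e0))) *\<^sub>R z) ` Kset x m \<eta> 1"
    using assms(2-5) \<open>0 \<in> Qset x m\<close>
    by (intro polar_translation compact_Kset convex_Kset zero_in_Kset inner_Kset_lt_1) auto
  also have "\<dots> = (\<lambda>z. (1 / (1 - (1 - \<eta>) * h)) *\<^sub>R z) ` Kset x m \<eta> \<kappa>"
    using perspective_convex_hull_Un[OF convex_Kset_top nonempty(1) convex_Kset_bottom nonempty(2)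
        level_top level_bottom assms(5,4)]
    by (simp add: Kset_eq_convex_hull assms(6))
  finally show ?thesis .
qed

end
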